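(* There is an on-line coloring algorithm for families of convex sets spanned between two lines, and a constant $C>0$, such that for every $\omega\ge 1$ and every on-line presented family of convex sets spanned between two lines whose intersection graph has clique number at most $\omega$, the algorithm produces a proper coloring of the intersection graph using at most $C\omega^3$ colors.
   Context: Fix two parallel horizontal lines $\ell^1,\ell^2$ in $\mathbb{R}^2$ and let $\mathbf{S}$ be the closed strip between them. A set is spanned between the two lines if it is a (compact, arc-connected) subset of $\mathbf{S}$ that has non-empty intersection with both $\ell^1$ and $\ell^2$. The intersection graph of a family of sets has the sets as vertices, two being adjacent iff they intersect. In the on-line coloring problem the sets are presented one at a time (by an adaptive adversary); when a set is presented the algorithm must immediately and irrevocably assign it a color, knowing only the sets presented so far, such that intersecting sets always receive distinct colors. The clique number $\omega$ is the maximum number of pairwise intersecting sets in the family. *)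

theory Defs
  imports "HOL-Analysis.Analysis"
begin

type_synonym point = "real \<times> real"

definition horizontal_line :: "real \<Rightarrow> point set" where
  "horizontal_line h = {p. snd p = h}"

definition closed_strip :: "real \<Rightarrow> real \<Rightarrow> point set" where
  "closed_strip h1 h2 = {p. min h1 h2 \<le> snd p \<and> snd p \<le> max h1 h2}"

definition arc_connected :: "'a::topological_space set \<Rightarrow> bool" where
  "arc_connected S \<longleftrightarrow> (\<forall>x\<in>S. \<forall>y\<in>S. x \<noteq> y \<longrightarrow>
     (\<exists>g. arc g \<and> path_image g \<subseteq> S \<and> pathstart g = x \<and> pathfinish g = y))"

definition spanned_between :: "real \<Rightarrow> real \<Rightarrow> point set \<Rightarrow> bool" where
  "spanned_between h1 h2 S \<longleftrightarrow>
     compact S \<and> arc_connected S \<and> S \<subseteq> closed_strip h1 h2 \<and>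
     S \<inter> horizontal_line h1 \<noteq> {} \<and> S \<inter> horizontal_line h2 \<noteq> {}"

text \<open>A simple graph is a pair of a vertex set and a set of two-element edges.\<close>

type_synonym 'v graph = "'v set \<times> 'v set set"

text \<open>An on-line presented family is the list of its members in order of presentation.
  The vertices are the positions in this list, so a set that is presented several times
  gives several, pairwise adjacent, vertices.\<close>

definition intersection_graph :: "'a set list \<Rightarrow> nat graph" where
  "intersection_graph F =
     ({..<length F},
      {{i, j} | i j. i < length F \<and> j < length F \<and> i \<noteq> j \<and> F ! i \<inter> F ! j \<noteq> {}})"

definition is_clique :: "'v graph \<Rightarrow> 'v set \<Rightarrow> bool" where
  "is_clique G K \<longleftrightarrow> K \<subseteq> fst G \<and> (\<forall>u\<in>K. \<forall>v\<in>K. u \<noteq> v \<longrightarrow> {u, v} \<in> snd G)"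

text \<open>Meaningful for finite graphs only.\<close>

definition clique_number :: "'v graph \<Rightarrow> nat" where
  "clique_number G = Max {card K | K. is_clique G K}"

definition proper_coloring :: "'v graph \<Rightarrow> ('v \<Rightarrow> nat) \<Rightarrow> bool" where
  "proper_coloring G c \<longleftrightarrow> (\<forall>u\<in>fst G. \<forall>v\<in>fst G. {u, v} \<in> snd G \<longrightarrow> c u \<noteq> c v)"

text \<open>A deterministic on-line coloring algorithm maps the list of the objects presented
  earlier and the newly presented object to a color. The colors given earlier need not be
  an argument, as the algorithm itself determines them from the earlier objects. For the
  same reason, an adaptive adversary is no more powerful than the collection of all
  possible presentations.\<close>

type_synonym 'a online_algorithm = "'a list \<Rightarrow> 'a \<Rightarrow> nat"

definition online_coloring :: "'a online_algorithm \<Rightarrow> 'a list \<Rightarrow> nat \<Rightarrow> nat" where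
  "online_coloring A F i = A (take i F) (F ! i)"

end

theory Submission
  imports Defs
begin

text \<open>
  By convexity every set contains the segment (its base) joining a point on one line to a point on
  the other. Two bases that cross do so in one of two directions, each of which is a transitive
  relation; first-fit with respect to each direction uses at most \<open>\<omega>\<close> colors, since a color value
  is witnessed by a chain, which is a clique. Within a class having the same pair of colors the bases
  are pairwise disjoint, hence linearly ordered from left to right. In such a class, mapping a set to
  the bases it meets shows that each base is met by at most \<open>2\<omega>\<close> sets, and that a base lying
  between two intersecting sets is met by one of them. So the class has pathwidth
  \<open>O(\<omega>)\<close>, and first-fit uses \<open>O(\<omega>)\<close> colors on it, by a column-labelling argument in the style of
  Pemmaraju, Raman and Varadarajan.
\<close>

section \<open>First-fit\<close>

text \<open>\<open>E\<close> is consulted only at pairs \<open>E j i\<close> with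
  \<open>j < i\<close>, so a relation that is not symmetric, such as crossing in one direction, can
  serve as well as a graph.\<close>

function first_fit :: "(nat \<Rightarrow> nat \<Rightarrow> bool) \<Rightarrow> nat \<Rightarrow> nat" where
  "first_fit E i = (LEAST c. c \<notin> first_fit E ` {j. j < i \<and> E j i})"
  by pat_completeness auto
termination
  by (relation "inv_image less_than snd") auto

declare first_fit.simps [simp del]

lemma first_fit_notin: "first_fit E i \<notin> first_fit E ` {j. j < i \<and> E j i}"
proof -
  have "finite (first_fit E ` {j. j < i \<and> E j i})"
    by simp
  then obtain c where "c \<notin> first_fit E ` {j. j < i \<and> E j i}"
    using ex_new_if_finite infinite_UNIV_nat by blast
  then show ?thesis
    by (subst first_fit.simps) (rule LeastI)
qed

lemma first_fit_neq: "j < i \<Longrightarrow> E j i \<Longrightarrow> first_fit E j \<noteq> first_fit E i"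
  using first_fit_notin[of E i] by (metis (mono_tags, lifting) imageI mem_Collect_eq)

lemma first_fit_below:
  assumes "c < first_fit E i"
  shows "\<exists>j<i. E j i \<and> first_fit E j = c"
proof -
  have "c < (LEAST c. c \<notin> first_fit E ` {j. j < i \<and> E j i})"
    using assms by (subst (asm) first_fit.simps)
  then show ?thesis
    using not_less_Least by blast
qed

text \<open>This makes first-fit an on-line rule: nothing presented after \<open>i\<close>
  influences the color of \<open>i\<close>.\<close>

lemma first_fit_cong:
  assumes "\<And>j k. j < k \<Longrightarrow> k \<le> i \<Longrightarrow> E j k = E' j k"
  shows "first_fit E i = first_fit E' i"
  using assms
proof (induction i rule: less_induct)
  case (less i)
  have "first_fit E ` {j. j < i \<and> E j i} = first_fit E' ` {j. j < i \<and> E' j i}"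
    using less by (intro image_cong) auto
  then show ?case
    by (simp add: first_fit.simps[of _ i])
qed

text \<open>A vertex \<open>i\<close> of color \<open>c + 1\<close> has an earlier predecessor
  \<open>u\<close> of color \<open>c\<close>, and by transitivity a chain ending at \<open>u\<close>
  extends by \<open>i\<close>. The conditions \<open>K \<subseteq> {..i}\<close> and
  \<open>i \<in> K\<close> record in the induction that the chain ends at \<open>i\<close>.\<close>

lemma first_fit_chain:
  assumes "\<And>i j k. E i j \<Longrightarrow> E j k \<Longrightarrow> E i k"
  shows "\<exists>K\<subseteq>{..i}. i \<in> K \<and> card K = Suc (first_fit E i) \<and> (\<forall>j\<in>K. \<forall>k\<in>K. j < k \<longrightarrow> E j k)"
proof (induction i rule: less_induct)
  case (less i)
  show ?case
  proof (cases "first_fit E i")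
    case 0
    then show ?thesis
      by (intro exI[of _ "{i}"]) auto
  next
    case (Suc c)
    then obtain u where u: "u < i" "E u i" "first_fit E u = c"
      using first_fit_below[of c E i] by auto
    obtain K where K: "K \<subseteq> {..u}" "u \<in> K" "card K = Suc (first_fit E u)"
        "\<forall>j\<in>K. \<forall>k\<in>K. j < k \<longrightarrow> E j k"
      using less[OF u(1)] by blast
    have "finite K" "i \<notin> K"
      using K(1) u(1) finite_subset by auto
    then have "card (insert i K) = Suc (first_fit E i)"
      using K(3) u(3) Suc by simp
    moreover have "E k i" if "k \<in> K" for k
    proof (cases "k = u")
      case False
      then have "k < u"
        using that K(1) by (auto simp: order.strict_iff_order)
      then show ?thesis
        using K(2,4) that u(2) assms by blast
    qed (use u in simp)
    moreover have "insert i K \<subseteq> {..i}"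
      using K(1) u(1) by auto
    ultimately show ?thesis
      using K(4) by (intro exI[of _ "insert i K"]) fastforce
  qed
qed

section \<open>Grundy colorings of graphs of bounded pathwidth\<close>

text \<open>The elements of \<open>P\<close> are both vertices and columns: \<open>J v\<close> holds
  the columns met by \<open>v\<close>, and \<open>key\<close> orders columns from left to right. In
  \<open>grundy\<close>, \<open>u\<close> stands for a neighbor of \<open>v\<close>: adjacent
  vertices need not share a column, but no column missed by both lies between them.\<close>

locale grundy_columns =
  fixes P :: "'a set" and key :: "'a \<Rightarrow> real" and J :: "'a \<Rightarrow> 'a set"
    and col :: "'a \<Rightarrow> nat" and w :: nat
  assumes finite_P: "finite P"
    and inj_key: "inj_on key P"
    and J_nonempty: "v \<in> P \<Longrightarrow> J v \<inter> P \<noteq> {}"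
    and depth: "x \<in> P \<Longrightarrow> card {v \<in> P. x \<in> J v} \<le> w"
    and grundy: "v \<in> P \<Longrightarrow> c < col v \<Longrightarrow> \<exists>u\<in>P. col u = c \<and>
      (\<forall>x\<in>J u \<inter> P. \<forall>y\<in>J v \<inter> P. \<forall>z\<in>P.
         (key x < key z \<and> key z < key y) \<or> (key y < key z \<and> key z < key x) \<longrightarrow> z \<in> J u \<union> J v)"
begin

definition hit :: "nat \<Rightarrow> 'a \<Rightarrow> bool" where
  "hit c x \<longleftrightarrow> (\<exists>u\<in>P. col u = c \<and> x \<in> J u)"

text \<open>The sign \<open>s\<close> is \<open>1\<close> for left and \<open>-1\<close> for right neighbors.\<close>

definition nbr :: "real \<Rightarrow> 'a set \<Rightarrow> 'a \<Rightarrow> 'a \<Rightarrow> bool" where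
  "nbr s A x y \<longleftrightarrow> s * key x < s * key y \<and> \<not> (\<exists>z\<in>A. s * key x < s * key z \<and> s * key z < s * key y)"

text \<open>Demanding \<open>\<not> hit c y\<close> separates this case from a direct hit, so that
  no color counts as both for one column.\<close>

definition nbr_hit :: "real \<Rightarrow> 'a set \<Rightarrow> nat \<Rightarrow> 'a \<Rightarrow> bool" where
  "nbr_hit s A c y \<longleftrightarrow> \<not> hit c y \<and> (\<exists>x\<in>A. nbr s A x y \<and> hit c x)"

text \<open>A column stays alive while its budget is nonnegative: being hit by a color earns 3, and a
  color that hits neither the column nor one of its alive neighbors costs 1.\<close>

primrec budget :: "nat \<Rightarrow> 'a \<Rightarrow> int" where
  "budget 0 x = 0"
| "budget (Suc c) x =
    (if budget c x < 0 then budget c x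
     else if hit c x then budget c x + 3
     else if \<exists>s\<in>{1, -1}. nbr_hit s {y \<in> P. 0 \<le> budget c y} c x then budget c x
     else budget c x - 1)"

text \<open>The state before color \<open>c\<close> is processed. The recursion of
  \<open>budget\<close> spells this set out, as it has to refer to the columns alive at the same
  stage.\<close>

definition alive :: "nat \<Rightarrow> 'a set" where
  "alive c = {x \<in> P. 0 \<le> budget c x}"

definition hits :: "nat \<Rightarrow> 'a \<Rightarrow> nat" where
  "hits j x = card {c. c < j \<and> hit c x}"

definition nbr_hits :: "real \<Rightarrow> nat \<Rightarrow> 'a \<Rightarrow> nat" where
  "nbr_hits s j x = card {c. c < j \<and> nbr_hit s (alive c) c x}"

section \<open>Counting the colors that hit an alive column or its neighbors\<close>

lemma card_less_Suc_filter:
  "card {c. c < Suc j \<and> Q c} = card {c. c < j \<and> Q c} + (if Q j then 1 else 0)"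
proof -
  have "{c. c < Suc j \<and> Q c} = {c. c < j \<and> Q c} \<union> (if Q j then {j} else {})"
    by (auto simp: less_Suc_eq)
  then show ?thesis
    by auto
qed

lemma hits_Suc: "hits (Suc j) x = hits j x + (if hit j x then 1 else 0)"
  unfolding hits_def by (rule card_less_Suc_filter)

lemma nbr_hits_Suc:
  "nbr_hits s (Suc j) x = nbr_hits s j x + (if nbr_hit s (alive j) j x then 1 else 0)"
  unfolding nbr_hits_def by (rule card_less_Suc_filter)

lemma alive_SucD: "x \<in> alive (Suc c) \<Longrightarrow> x \<in> alive c"
  by (auto simp: alive_def split: if_splits)

lemma budget_Suc_alive:
  assumes "x \<in> alive c"
  shows "budget (Suc c) x =
    (if hit c x then budget c x + 3
     else if \<exists>s\<in>{1, -1}. nbr_hit s (alive c) c x then budget c x else budget c x - 1)"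
  using assms by (simp add: alive_def)

lemma budget_le_hits: "budget j x \<le> 3 * int (hits j x)"
  by (induction j) (simp_all add: hits_Suc)

lemma hits_le:
  assumes "x \<in> P"
  shows "hits j x \<le> w"
proof -
  have "{c. c < j \<and> hit c x} \<subseteq> col ` {v \<in> P. x \<in> J v}"
    by (auto simp: hit_def)
  then have "hits j x \<le> card {v \<in> P. x \<in> J v}"
    unfolding hits_def using finite_P by (intro surj_card_le) auto
  then show ?thesis
    using depth[OF assms] by simp
qed

text \<open>Passing one color raises the left side by 4 at a hit, by 1 at a neighbor hit and by 0
  otherwise; the right side rises by at least as much.\<close>

lemma column_height:
  assumes "x \<in> alive j"
  shows "int j + budget j x \<le> 4 * int (hits j x) + int (nbr_hits 1 j x) + int (nbr_hits (-1) j x)"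
  using assms
proof (induction j)
  case (Suc j)
  then have x: "x \<in> alive j"
    using alive_SucD by blast
  show ?case
    using Suc.IH[OF x] unfolding budget_Suc_alive[OF x] hits_Suc nbr_hits_Suc
    by auto
qed (simp add: hits_def nbr_hits_def)

lemma nbr_unique:
  assumes "s \<in> {1, -1}" "A \<subseteq> P" "x \<in> A" "x' \<in> A" "nbr s A x y" "nbr s A x' y"
  shows "x = x'"
proof -
  have "\<not> s * key x < s * key x'" "\<not> s * key x' < s * key x"
    using assms unfolding nbr_def by blast+
  then have "key x = key x'"
    using assms(1) by auto
  then show ?thesis
    using inj_key assms(2-4) by (auto simp: inj_on_def)
qed

lemma nbr_exists:
  assumes "A \<subseteq> P" "x \<in> A" "s * key x < s * key y"
  shows "\<exists>z\<in>A. nbr s A z y"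
proof -
  let ?B = "{z \<in> A. s * key z < s * key y}"
  have fin: "finite ?B" "?B \<noteq> {}"
    using assms finite_subset[OF assms(1) finite_P] by auto
  \<comment> \<open>Minimizing the negated signed key picks the column closest to \<open>y\<close>
    on the chosen side.\<close>
  define z where "z = arg_min_on (\<lambda>z. - (s * key z)) ?B"
  have "z \<in> ?B" "\<And>t. t \<in> ?B \<Longrightarrow> \<not> s * key z < s * key t"
    unfolding z_def using arg_min_if_finite[OF fin, of "\<lambda>z. - (s * key z)"]
    by (blast, simp only: neg_less_iff_less, blast)
  then show ?thesis
    unfolding nbr_def by (metis (mono_tags, lifting) mem_Collect_eq)
qed

text \<open>The budget of the current neighbor serves as potential: a neighbor that dies has a negative
  budget, so exchanging it for another alive column only raises the bound.\<close>

lemma nbr_hits_potential: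
  assumes s: "s \<in> {1, -1}" and "x \<in> alive j"
  shows "(\<exists>y\<in>alive j. nbr s (alive j) y x \<and> 4 * int (nbr_hits s j x) \<le> int j + budget j y) \<or>
    (\<not> (\<exists>y\<in>alive j. s * key y < s * key x) \<and> 4 * int (nbr_hits s j x) \<le> int j)"
  using assms(2)
proof (induction j)
  case 0
  show ?case
  proof (cases "\<exists>y\<in>alive 0. s * key y < s * key x")
    case True
    then obtain y where "y \<in> alive 0" "nbr s (alive 0) y x"
      using nbr_exists[of "alive 0" _ s x] unfolding alive_def by blast
    then show ?thesis
      by (auto simp: nbr_hits_def)
  qed (simp add: nbr_hits_def)
next
  case (Suc j)
  have x: "x \<in> alive j" and sub: "alive (Suc j) \<subseteq> alive j"
    using Suc.prems alive_SucD by blast+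
  have aP: "alive j \<subseteq> P" "alive (Suc j) \<subseteq> P"
    by (auto simp: alive_def)
  consider (nbr) y where "y \<in> alive j" "nbr s (alive j) y x"
      "4 * int (nbr_hits s j x) \<le> int j + budget j y"
    | (none) "\<not> (\<exists>y\<in>alive j. s * key y < s * key x)" "4 * int (nbr_hits s j x) \<le> int j"
    using Suc.IH[OF x] by blast
  then show ?case
  proof cases
    case nbr
    have "hit j y" if "nbr_hit s (alive j) j x"
      using that nbr_unique[OF s aP(1) _ nbr(1) _ nbr(2)] unfolding nbr_hit_def by blast
    \<comment> \<open>A neighbor hit means that \<open>y\<close> itself is hit: it earns 3 while
      \<open>j\<close> grows by 1, which pays for the 4 on the left. Otherwise the budget drops by
      at most 1, which the growth of \<open>j\<close> offsets.\<close>
    then have le: "4 * int (nbr_hits s (Suc j) x) \<le> int (Suc j) + budget (Suc j) y"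
      using nbr(3) unfolding nbr_hits_Suc budget_Suc_alive[OF nbr(1)] by auto
    show ?thesis
    proof (cases "y \<in> alive (Suc j)")
      case True
      moreover have "nbr s (alive (Suc j)) y x"
        using nbr(2) sub unfolding nbr_def by blast
      ultimately show ?thesis
        using le by blast
    next
      case False
      then have le': "4 * int (nbr_hits s (Suc j) x) \<le> int (Suc j)"
        using le nbr(1) by (auto simp: alive_def simp del: budget.simps)
      show ?thesis
      proof (cases "\<exists>y\<in>alive (Suc j). s * key y < s * key x")
        case True
        then obtain z where z: "z \<in> alive (Suc j)" "nbr s (alive (Suc j)) z x"
          using nbr_exists[OF aP(2)] by blast
        moreover have "0 \<le> budget (Suc j) z"
          using z(1) unfolding alive_def by blast
        then have "4 * int (nbr_hits s (Suc j) x) \<le> int (Suc j) + budget (Suc j) z"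
          using le' by linarith
        ultimately show ?thesis
          by blast
      qed (use le' in blast)
    qed
  next
    case none
    then have "\<not> nbr_hit s (alive j) j x"
      unfolding nbr_hit_def nbr_def by blast
    then show ?thesis
      using none sub unfolding nbr_hits_Suc by auto
  qed
qed

text \<open>The potential of a neighbor is at most 3 per hit, and a column has at most
  \<open>w\<close> hits. Up to an additive term in \<open>w\<close>, each side thus accounts for at
  most a quarter of the colors.\<close>

lemma nbr_hits_le:
  assumes "s \<in> {1, -1}" "x \<in> alive j"
  shows "4 * nbr_hits s j x \<le> j + 3 * w"
proof -
  have "budget j y \<le> 3 * int w" if "y \<in> alive j" for y
    using budget_le_hits[of j y] hits_le[of y j] that by (auto simp: alive_def)
  then show ?thesis
    using nbr_hits_potential[OF assms] by fastforce
qed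

text \<open>Let \<open>v\<close> have color above \<open>j\<close> and let \<open>u\<close> be its
  witness of color \<open>j\<close>; by induction both still meet alive columns. For a closest pair
  of alive columns \<open>x\<close> in \<open>J u\<close> and \<open>y\<close> in
  \<open>J v\<close>, an alive column in between would lie in \<open>J u\<close> or
  \<open>J v\<close> and give a closer pair. Hence \<open>x\<close> equals \<open>y\<close> or is
  its alive neighbor, so color \<open>j\<close> costs \<open>y\<close> nothing and \<open>y\<close>
  survives.\<close>

lemma alive_meets:
  assumes "v \<in> P" "j \<le> col v"
  shows "J v \<inter> alive j \<noteq> {}"
  using assms
proof (induction j arbitrary: v)
  case 0
  then show ?case
    using J_nonempty by (auto simp: alive_def)
next
  case (Suc j)
  obtain u where u: "u \<in> P" "col u = j"
    and link: "\<And>x y z. x \<in> J u \<Longrightarrow> x \<in> P \<Longrightarrow> y \<in> J v \<Longrightarrow> y \<in> P \<Longrightarrow> z \<in> P \<Longrightarrow>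
      (key x < key z \<and> key z < key y) \<or> (key y < key z \<and> key z < key x) \<Longrightarrow> z \<in> J u \<union> J v"
    using grundy[of v j] Suc.prems by (auto simp: Ball_def)
  let ?U = "J u \<inter> alive j" and ?V = "J v \<inter> alive j"
  have aP: "alive j \<subseteq> P"
    by (auto simp: alive_def)
  have fin: "finite (?U \<times> ?V)" "?U \<times> ?V \<noteq> {}"
    using Suc.IH[of u] Suc.IH[of v] Suc.prems u finite_subset[OF aP finite_P] by auto
  have keep: "y \<in> alive (Suc j)"
    if "y \<in> alive j" "hit j y \<or> (\<exists>s\<in>{1, -1}. nbr_hit s (alive j) j y)" for y
  proof -
    have "budget j y \<le> budget (Suc j) y"
      using that(2) unfolding budget_Suc_alive[OF that(1)] by auto
    then show ?thesis
      using that(1) unfolding alive_def by auto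
  qed
  define q where "q = arg_min_on (\<lambda>(x, y). \<bar>key x - key y\<bar>) (?U \<times> ?V)"
  obtain x y where q: "q = (x, y)"
    by fastforce
  have "q \<in> ?U \<times> ?V" "\<not> (\<exists>p\<in>?U \<times> ?V. (\<lambda>(x, y). \<bar>key x - key y\<bar>) p < (\<lambda>(x, y). \<bar>key x - key y\<bar>) q)"
    unfolding q_def using arg_min_if_finite[OF fin, of "\<lambda>(x, y). \<bar>key x - key y\<bar>"] by blast+
  then have xy: "x \<in> ?U" "y \<in> ?V"
    and closest: "\<And>x' y'. x' \<in> ?U \<Longrightarrow> y' \<in> ?V \<Longrightarrow> \<bar>key x - key y\<bar> \<le> \<bar>key x' - key y'\<bar>"
    unfolding q by (auto simp: not_less)
  have gap: False
    if z: "z \<in> alive j" and btw: "(key x < key z \<and> key z < key y) \<or> (key y < key z \<and> key z < key x)" for z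
  proof -
    have "z \<in> ?U \<or> z \<in> ?V"
      using link[of x y z] xy z btw aP by blast
    then have "\<bar>key x - key y\<bar> \<le> \<bar>key z - key y\<bar> \<or> \<bar>key x - key y\<bar> \<le> \<bar>key x - key z\<bar>"
      using closest xy by blast
    then show False
      using btw by linarith
  qed
  have hx: "hit j x"
    using u xy unfolding hit_def by blast
  have "hit j y \<or> (\<exists>s\<in>{1, -1}. nbr_hit s (alive j) j y)"
  proof (cases "hit j y")
    case False
    then have "key x \<noteq> key y"
      using hx inj_key xy aP by (auto simp: inj_on_def)
    then consider "key x < key y" | "key y < key x"
      by linarith
    then show ?thesis
    proof cases
      case 1
      then have "nbr 1 (alive j) x y"
        using gap unfolding nbr_def by auto
      then show ?thesis
        using xy hx False unfolding nbr_hit_def by blast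
    next
      case 2
      then have "nbr (-1) (alive j) x y"
        using gap unfolding nbr_def by auto
      then show ?thesis
        using xy hx False unfolding nbr_hit_def by blast
    qed
  qed simp
  then show ?case
    using keep xy by blast
qed

text \<open>For \<open>j = col v\<close>, an alive column with at most \<open>w\<close> hits and at
  most \<open>(j + 3 * w) / 4\<close> neighbor hits on each side gives
  \<open>j \<le> 4 * w + (j + 3 * w) / 2\<close>, that is \<open>j \<le> 11 * w\<close>.\<close>

theorem color_le:
  assumes "v \<in> P"
  shows "col v \<le> 11 * w"
proof -
  obtain x where x: "x \<in> alive (col v)"
    using alive_meets[OF assms order.refl] by blast
  then have "0 \<le> budget (col v) x" "hits (col v) x \<le> w"
    using hits_le by (auto simp: alive_def)
  then show ?thesis
    using column_height[OF x] nbr_hits_le[OF _ x, of 1] nbr_hits_le[OF _ x, of "-1"] by simp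
qed

end

section \<open>Convex sets between two lines\<close>

text \<open>The choice depends on \<open>S\<close> and the line alone, so the feet of a set are
  known once it is presented and never change.\<close>

definition foot :: "real \<Rightarrow> point set \<Rightarrow> real" where
  "foot h S = (SOME x. (x, h) \<in> S)"

text \<open>Signed horizontal distance of \<open>p\<close> from the line through the two feet,
  positive to its right; the quotient is the height rescaled to run from 0 to 1.\<close>

definition side :: "real \<Rightarrow> real \<Rightarrow> point set \<Rightarrow> point \<Rightarrow> real" where
  "side h1 h2 S p = fst p - (foot h1 S + (foot h2 S - foot h1 S) * ((snd p - h1) / (h2 - h1)))"

definition base :: "real \<Rightarrow> real \<Rightarrow> point set \<Rightarrow> point set" where
  "base h1 h2 S = {p \<in> closed_strip h1 h2. side h1 h2 S p = 0}"

lemma foot_mem: "S \<inter> horizontal_line h \<noteq> {} \<Longrightarrow> (foot h S, h) \<in> S"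
  unfolding foot_def by (rule someI_ex) (auto simp: horizontal_line_def)

lemma strip_parameter:
  fixes h1 h2 :: real
  assumes "h1 \<noteq> h2" "p \<in> closed_strip h1 h2"
  shows "0 \<le> (snd p - h1) / (h2 - h1)" "(snd p - h1) / (h2 - h1) \<le> 1"
  using assms by (auto simp: closed_strip_def divide_simps split: if_splits)

lemma side_mono:
  assumes "h1 \<noteq> h2" "p \<in> closed_strip h1 h2" "foot h1 S \<le> foot h1 T" "foot h2 S \<le> foot h2 T"
  shows "side h1 h2 T p \<le> side h1 h2 S p"
proof -
  define t where "t = (snd p - h1) / (h2 - h1)"
  have "0 \<le> t" "t \<le> 1"
    unfolding t_def using strip_parameter[OF assms(1,2)] by auto
  \<comment> \<open>At a fixed height, the base position is the convex combination of the feet with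
    weights \<open>1 - t\<close> and \<open>t\<close>.\<close>
  then have "0 \<le> (foot h1 T - foot h1 S) * (1 - t) + (foot h2 T - foot h2 S) * t"
    using assms by (intro add_nonneg_nonneg mult_nonneg_nonneg) auto
  then show ?thesis
    unfolding side_def t_def[symmetric] by (simp add: algebra_simps)
qed

text \<open>Ties count as crossing, so two sets that cross in neither direction have their feet
  strictly in the same order on both lines.\<close>

definition crosses :: "real \<Rightarrow> real \<Rightarrow> point set \<Rightarrow> point set \<Rightarrow> bool" where
  "crosses h1 h2 S T \<longleftrightarrow> foot h1 T \<le> foot h1 S \<and> foot h2 S \<le> foot h2 T"

lemma crosses_trans: "crosses h1 h2 S T \<Longrightarrow> crosses h1 h2 T U \<Longrightarrow> crosses h1 h2 S U"
  by (auto simp: crosses_def)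

section \<open>Intersections forced by convexity\<close>

locale two_lines =
  fixes h1 h2 :: real
  assumes h: "h1 \<noteq> h2"
begin

abbreviation spanned :: "point set \<Rightarrow> bool" where
  "spanned S \<equiv> convex S \<and> spanned_between h1 h2 S"

lemma spanned_subset: "spanned S \<Longrightarrow> S \<subseteq> closed_strip h1 h2"
  by (simp add: spanned_between_def)

lemma feet_mem: "spanned S \<Longrightarrow> (foot h1 S, h1) \<in> S" "spanned S \<Longrightarrow> (foot h2 S, h2) \<in> S"
  using foot_mem by (auto simp: spanned_between_def)

lemma side_feet:
  "side h1 h2 S (x, h1) = x - foot h1 S" "side h1 h2 S (x, h2) = x - foot h2 S"
  using h by (auto simp: side_def)

lemma base_subset:
  assumes "spanned S"
  shows "base h1 h2 S \<subseteq> S"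
proof
  fix p assume p: "p \<in> base h1 h2 S"
  define t where "t = (snd p - h1) / (h2 - h1)"
  have t: "0 \<le> t" "t \<le> 1"
    unfolding t_def using strip_parameter[OF h] p by (auto simp: base_def)
  have "snd p = h1 + t * (h2 - h1)"
    unfolding t_def using h by simp
  moreover have "fst p = foot h1 S + (foot h2 S - foot h1 S) * t"
    using p unfolding base_def side_def t_def by simp
  ultimately have "p = (1 - t) *\<^sub>R (foot h1 S, h1) + t *\<^sub>R (foot h2 S, h2)"
    by (simp add: prod_eq_iff algebra_simps)
  then show "p \<in> S"
    using convexD[of S "(foot h1 S, h1)" "(foot h2 S, h2)" "1 - t" t] assms feet_mem t by simp
qed

text \<open>Intermediate value theorem for the continuous function \<open>side\<close> on the
  connected set \<open>S\<close>.\<close>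

lemma meets_base:
  assumes "spanned S" "p \<in> S" "side h1 h2 T p \<le> 0" "q \<in> S" "0 \<le> side h1 h2 T q"
  shows "S \<inter> base h1 h2 T \<noteq> {}"
proof -
  have "continuous_on S (side h1 h2 T)"
    unfolding side_def using h by (intro continuous_intros) auto
  then have "connected (side h1 h2 T ` S)"
    using assms(1) convex_connected connected_continuous_image by blast
  then have "0 \<in> side h1 h2 T ` S"
    using assms(2-5) connectedD_interval[of "side h1 h2 T ` S" "side h1 h2 T p" "side h1 h2 T q" 0]
    by blast
  then show ?thesis
    using spanned_subset[OF assms(1)] by (auto simp: base_def)
qed

lemma crosses_meet:
  assumes "spanned S" "spanned T" "crosses h1 h2 S T"
  shows "S \<inter> T \<noteq> {}"
proof -
  have "S \<inter> base h1 h2 T \<noteq> {}"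
    using meets_base[OF assms(1) feet_mem(2)[OF assms(1)] _ feet_mem(1)[OF assms(1)], of T] assms(3)
    by (simp add: side_feet crosses_def)
  then show ?thesis
    using base_subset[OF assms(2)] by blast
qed

text \<open>\<open>S\<close> has a point weakly left of the base of \<open>Z\<close>,
  \<open>U\<close> has one weakly right of it, and they share a point \<open>p\<close>. If
  \<open>p\<close> is weakly right of that base, \<open>S\<close> reaches across it; otherwise
  \<open>U\<close> does.\<close>

lemma base_between:
  assumes "spanned S" "spanned U" "S \<inter> U \<noteq> {}"
    and "S \<inter> base h1 h2 X \<noteq> {}" "U \<inter> base h1 h2 Y \<noteq> {}"
    and "foot h1 X \<le> foot h1 Z" "foot h2 X \<le> foot h2 Z" "foot h1 Z \<le> foot h1 Y" "foot h2 Z \<le> foot h2 Y"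
  shows "S \<inter> base h1 h2 Z \<noteq> {} \<or> U \<inter> base h1 h2 Z \<noteq> {}"
proof -
  obtain p q r where p: "p \<in> S" "p \<in> U" and q: "q \<in> S" "q \<in> base h1 h2 X"
    and r: "r \<in> U" "r \<in> base h1 h2 Y"
    using assms(3-5) by blast
  have "side h1 h2 Z q \<le> 0"
    using side_mono[OF h _ assms(6,7), of q] q by (auto simp: base_def)
  moreover have "0 \<le> side h1 h2 Z r"
    using side_mono[OF h _ assms(8,9), of r] r by (auto simp: base_def)
  ultimately show ?thesis
    using meets_base[OF assms(1) q(1) _ p(1), of Z] meets_base[OF assms(2) p(2) _ r(1), of Z]
    by linarith
qed

text \<open>A set that reaches the base of \<open>T\<close> passes through all bases on its way.\<close>

lemma meet_of_reach:
  assumes "spanned S" "spanned U" "S \<inter> base h1 h2 T \<noteq> {}"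
    and "(foot h1 S \<le> foot h1 U \<and> foot h2 S \<le> foot h2 U \<and> foot h1 U \<le> foot h1 T \<and> foot h2 U \<le> foot h2 T) \<or>
         (foot h1 T \<le> foot h1 U \<and> foot h2 T \<le> foot h2 U \<and> foot h1 U \<le> foot h1 S \<and> foot h2 U \<le> foot h2 S)"
  shows "S \<inter> U \<noteq> {}"
proof -
  have "(foot h1 S, h1) \<in> S \<inter> base h1 h2 S"
    using feet_mem[OF assms(1)] spanned_subset[OF assms(1)] by (auto simp: base_def side_feet)
  then have S: "S \<inter> base h1 h2 S \<noteq> {}"
    by blast
  \<comment> \<open>\<open>base_between\<close> with \<open>S\<close> in both roles, going from its
    own base to that of \<open>T\<close>, one instance for each direction.\<close>
  have "S \<inter> base h1 h2 U \<noteq> {}"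
    using base_between[OF assms(1) assms(1) _ S assms(3), of U]
      base_between[OF assms(1) assms(1) _ assms(3) S, of U] S assms(4) by blast
  then show ?thesis
    using base_subset[OF assms(2)] by blast
qed

end

section \<open>The algorithm\<close>

lemma clique_card_le:
  assumes "is_clique (intersection_graph F) K"
  shows "card K \<le> clique_number (intersection_graph F)"
proof -
  have "{card K | K. is_clique (intersection_graph F) K} \<subseteq> card ` Pow {..<length F}"
    by (auto simp: is_clique_def intersection_graph_def)
  then have "finite {card K | K. is_clique (intersection_graph F) K}"
    using finite_subset by blast
  then show ?thesis
    unfolding clique_number_def using assms by (intro Max_ge) auto
qed

text \<open>An injective rank \<open>r\<close> lets each pair be treated in one order only, since
  meeting is symmetric.\<close>

lemma is_clique_intersection_graphI:
  assumes "K \<subseteq> {..<length F}"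
    and "\<And>i j. i \<in> K \<Longrightarrow> j \<in> K \<Longrightarrow> r i < (r j :: 'b::linorder) \<Longrightarrow> F ! i \<inter> F ! j \<noteq> {}"
    and "inj_on r K"
  shows "is_clique (intersection_graph F) K"
proof -
  have "{i, j} \<in> snd (intersection_graph F)" if "i \<in> K" "j \<in> K" "i \<noteq> j" for i j
  proof -
    have "r i < r j \<or> r j < r i"
      using that inj_onD[OF assms(3)] neq_iff[of "r i" "r j"] by blast
    then have "F ! i \<inter> F ! j \<noteq> {}"
      using assms(2) that by blast
    then show ?thesis
      using that assms(1) by (auto simp: intersection_graph_def)
  qed
  then show ?thesis
    using assms(1) by (auto simp: is_clique_def intersection_graph_def)
qed

section \<open>Three first-fit colorings and the on-line algorithm\<close>

context two_lines
begin

definition down_color :: "point set list \<Rightarrow> nat \<Rightarrow> nat" where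
  "down_color F = first_fit (\<lambda>j i. crosses h1 h2 (F ! j) (F ! i))"

text \<open>Whichever way an earlier and a later set cross, one of the two direction colors tells
  them apart. Hence sets that agree in both never cross.\<close>

definition up_color :: "point set list \<Rightarrow> nat \<Rightarrow> nat" where
  "up_color F = first_fit (\<lambda>j i. crosses h1 h2 (F ! i) (F ! j))"

definition class_color :: "point set list \<Rightarrow> nat \<Rightarrow> nat" where
  "class_color F = first_fit (\<lambda>j i. down_color F j = down_color F i \<and>
     up_color F j = up_color F i \<and> F ! j \<inter> F ! i \<noteq> {})"

definition strip_color :: "point set list \<Rightarrow> nat \<Rightarrow> nat" where
  "strip_color F i = prod_encode (down_color F i, prod_encode (up_color F i, class_color F i))"

definition strip_algorithm :: "point set online_algorithm" where
  "strip_algorithm F S = strip_color (F @ [S]) (length F)"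

lemma down_color_neq: "j < i \<Longrightarrow> crosses h1 h2 (F ! j) (F ! i) \<Longrightarrow> down_color F j \<noteq> down_color F i"
  unfolding down_color_def by (rule first_fit_neq)

lemma up_color_neq: "j < i \<Longrightarrow> crosses h1 h2 (F ! i) (F ! j) \<Longrightarrow> up_color F j \<noteq> up_color F i"
  unfolding up_color_def by (rule first_fit_neq)

lemma class_color_neq:
  assumes "j < i" "down_color F j = down_color F i" "up_color F j = up_color F i" "F ! j \<inter> F ! i \<noteq> {}"
  shows "class_color F j \<noteq> class_color F i"
  unfolding class_color_def using assms by (intro first_fit_neq) auto

lemma class_color_below:
  assumes "c < class_color F i"
  obtains j where "j < i" "down_color F j = down_color F i" "up_color F j = up_color F i"
    "F ! j \<inter> F ! i \<noteq> {}" "class_color F j = c"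
  using first_fit_below[OF assms[unfolded class_color_def], folded class_color_def] that by blast

text \<open>All three first-fit rules look only at positions up to \<open>i\<close>, so recomputing
  on a prefix, as \<open>strip_algorithm\<close> does, reproduces the colors given earlier.\<close>

lemma strip_color_cong:
  assumes "\<And>k. k \<le> i \<Longrightarrow> F ! k = G ! k"
  shows "strip_color F i = strip_color G i"
proof -
  have *: "down_color F k = down_color G k" "up_color F k = up_color G k" if "k \<le> i" for k
    unfolding down_color_def up_color_def using that assms by (auto intro!: first_fit_cong)
  have "class_color F i = class_color G i"
    unfolding class_color_def using assms * by (intro first_fit_cong) auto
  then show ?thesis
    using * by (simp add: strip_color_def)
qed

lemma online_coloring_strip_algorithm:
  assumes "i < length F"
  shows "online_coloring strip_algorithm F i = strip_color F i"
proof -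
  have "take i F @ [F ! i] = take (Suc i) F"
    using assms by (simp add: take_Suc_conv_app_nth)
  then have "online_coloring strip_algorithm F i = strip_color (take (Suc i) F) i"
    using assms by (simp add: online_coloring_def strip_algorithm_def)
  also have "\<dots> = strip_color F i"
    by (intro strip_color_cong) simp
  finally show ?thesis .
qed

lemma strip_color_neq:
  assumes "j < i" "F ! j \<inter> F ! i \<noteq> {}"
  shows "strip_color F j \<noteq> strip_color F i"
proof
  assume "strip_color F j = strip_color F i"
  then have "down_color F j = down_color F i" "up_color F j = up_color F i"
    "class_color F j = class_color F i"
    by (simp_all add: strip_color_def)
  then show False
    using class_color_neq assms by blast
qed

lemma proper_strip_algorithm:
  "proper_coloring (intersection_graph F) (online_coloring strip_algorithm F)"
  unfolding proper_coloring_def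
proof (intro ballI impI)
  fix u v assume "{u, v} \<in> snd (intersection_graph F)"
  then have uv: "u < length F" "v < length F" "u \<noteq> v" "F ! u \<inter> F ! v \<noteq> {}"
    by (auto simp: intersection_graph_def doubleton_eq_iff)
  have "strip_color F u \<noteq> strip_color F v"
    using strip_color_neq[of u v F] strip_color_neq[of v u F] uv
    by (metis Int_commute linorder_neqE_nat)
  then show "online_coloring strip_algorithm F u \<noteq> online_coloring strip_algorithm F v"
    using uv by (simp add: online_coloring_strip_algorithm)
qed

section \<open>Number of colors under a clique bound\<close>

context
  fixes F :: "point set list" and \<omega> :: nat
  assumes F: "S \<in> set F \<Longrightarrow> spanned S"
    and clique: "clique_number (intersection_graph F) \<le> \<omega>"
begin

lemma spanned_nth: "i < length F \<Longrightarrow> spanned (F ! i)"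
  using F nth_mem by blast

text \<open>The chain behind color \<open>c\<close> is a clique with \<open>c + 1\<close> members,
  hence the strict bound.\<close>

lemma first_fit_less_clique:
  assumes "\<And>i j k. E i j \<Longrightarrow> E j k \<Longrightarrow> E i k"
    and "\<And>i j. i < length F \<Longrightarrow> j < length F \<Longrightarrow> E i j \<Longrightarrow> F ! i \<inter> F ! j \<noteq> {}"
    and "i < length F"
  shows "first_fit E i < \<omega>"
proof -
  obtain K where K: "K \<subseteq> {..i}" "card K = Suc (first_fit E i)"
    "\<forall>j\<in>K. \<forall>k\<in>K. j < k \<longrightarrow> E j k"
    using first_fit_chain[of E i] assms(1) by blast
  have K': "K \<subseteq> {..<length F}"
    using K(1) assms(3) by auto
  then have "is_clique (intersection_graph F) K"
    using K(3) assms(2) by (intro is_clique_intersection_graphI[where r = id]) auto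
  then show ?thesis
    using clique_card_le K(2) clique by fastforce
qed

lemma down_color_less:
  assumes "i < length F"
  shows "down_color F i < \<omega>"
  unfolding down_color_def
proof (rule first_fit_less_clique)
  show "F ! i \<inter> F ! j \<noteq> {}" if "i < length F" "j < length F" "crosses h1 h2 (F ! i) (F ! j)" for i j
    using crosses_meet[OF spanned_nth[OF that(1)] spanned_nth[OF that(2)]] that(3) by blast
qed (use crosses_trans assms in auto)

lemma up_color_less:
  assumes "i < length F"
  shows "up_color F i < \<omega>"
  unfolding up_color_def
proof (rule first_fit_less_clique)
  show "F ! i \<inter> F ! j \<noteq> {}" if "i < length F" "j < length F" "crosses h1 h2 (F ! j) (F ! i)" for i j
    using crosses_meet[OF spanned_nth[OF that(2)] spanned_nth[OF that(1)]] that(3) by blast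
qed (use crosses_trans assms in auto)

lemma class_color_le:
  assumes "i < length F"
  shows "class_color F i \<le> 22 * \<omega>"
proof -
  define P where "P = {j. j < length F \<and> down_color F j = down_color F i \<and> up_color F j = up_color F i}"
  define J where "J = (\<lambda>j. {k. F ! j \<inter> base h1 h2 (F ! k) \<noteq> {}})"
  let ?key = "\<lambda>j. foot h1 (F ! j)"
  \<comment> \<open>Equal direction colors rule out both crossings, whichever set came first, which
    leaves a strict left-to-right order common to both lines.\<close>
  have ordered: "?key j < ?key k \<and> foot h2 (F ! j) < foot h2 (F ! k) \<or>
      ?key k < ?key j \<and> foot h2 (F ! k) < foot h2 (F ! j)"
    if "j \<in> P" "k \<in> P" "j \<noteq> k" for j k
  proof -
    have same: "down_color F j = down_color F k" "up_color F j = up_color F k"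
      using that by (auto simp: P_def)
    have "\<not> crosses h1 h2 (F ! l) (F ! m) \<and> \<not> crosses h1 h2 (F ! m) (F ! l)"
      if "l < m" "down_color F l = down_color F m" "up_color F l = up_color F m" for l m
      using that down_color_neq up_color_neq by blast
    from this[of j k] this[of k j]
    have "\<not> crosses h1 h2 (F ! j) (F ! k) \<and> \<not> crosses h1 h2 (F ! k) (F ! j)"
      using same same[symmetric] that(3) neq_iff[of j k] by blast
    then show ?thesis
      unfolding crosses_def by linarith
  qed
  have inj: "inj_on ?key P"
  proof (rule inj_onI)
    show "j = k" if "j \<in> P" "k \<in> P" "?key j = ?key k" for j k
      using ordered[OF that(1,2)] that(3) by linarith
  qed
  have mono: "foot h2 (F ! j) \<le> foot h2 (F ! k)" if "j \<in> P" "k \<in> P" "?key j \<le> ?key k" for j k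
    using ordered[OF that(1,2)] that(3) by (cases "j = k") auto
  have spanned: "spanned (F ! j)" if "j \<in> P" for j
    using that spanned_nth by (simp add: P_def)
  have P_sub: "P \<subseteq> {..<length F}"
    by (auto simp: P_def)
  have self: "j \<in> J j" if "j \<in> P" for j
  proof -
    have "(?key j, h1) \<in> F ! j \<inter> base h1 h2 (F ! j)"
      using feet_mem[OF spanned[OF that]] spanned_subset[OF spanned[OF that]]
      by (auto simp: base_def side_feet)
    then show ?thesis
      unfolding J_def by blast
  qed
  have "grundy_columns P ?key J (class_color F) (2 * \<omega>)"
  proof
    show "finite P"
      using P_sub finite_subset by blast
    show "inj_on ?key P"
      by (rule inj)
  next
    fix v assume "v \<in> P"
    then show "J v \<inter> P \<noteq> {}"
      using self by blast
  next
    fix x assume x: "x \<in> P"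
    \<comment> \<open>Among the sets that reach the base of \<open>x\<close> from one side, one
      starting farther away must pass through the base of each nearer one. So each side forms a
      clique, and the depth is at most \<open>2 * \<omega>\<close>.\<close>
    let ?L = "{v \<in> P. x \<in> J v \<and> ?key v \<le> ?key x}" and ?R = "{v \<in> P. x \<in> J v \<and> ?key x \<le> ?key v}"
    have meet: "F ! j \<inter> F ! k \<noteq> {}"
      if "j \<in> P" "k \<in> P" "x \<in> J j" "?key j \<le> ?key k \<and> ?key k \<le> ?key x \<or> ?key x \<le> ?key k \<and> ?key k \<le> ?key j"
      for j k
    proof (rule meet_of_reach[where T = "F ! x"])
      show "F ! j \<inter> base h1 h2 (F ! x) \<noteq> {}"
        using that(3) by (simp add: J_def)
    qed (use that mono x spanned in auto)
    have "is_clique (intersection_graph F) ?L"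
    proof (rule is_clique_intersection_graphI)
      show "inj_on ?key ?L"
        by (rule inj_on_subset[OF inj]) blast
      show "F ! j \<inter> F ! k \<noteq> {}" if "j \<in> ?L" "k \<in> ?L" "?key j < ?key k" for j k
        using meet[of j k] that by simp
    qed (use P_sub in blast)
    moreover have "is_clique (intersection_graph F) ?R"
    proof (rule is_clique_intersection_graphI)
      \<comment> \<open>On the right the farther set has the larger key; negation again ranks the
        farther set first.\<close>
      show "inj_on (\<lambda>j. - ?key j) ?R"
        using inj by (simp add: inj_on_def)
      show "F ! j \<inter> F ! k \<noteq> {}" if "j \<in> ?R" "k \<in> ?R" "- ?key j < - ?key k" for j k
        using meet[of j k] that by simp
    qed (use P_sub in blast)
    ultimately have "card ?L \<le> \<omega>" "card ?R \<le> \<omega>"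
      using clique_card_le clique order.trans by blast+
    moreover have "{v \<in> P. x \<in> J v} = ?L \<union> ?R"
      by auto
    ultimately show "card {v \<in> P. x \<in> J v} \<le> 2 * \<omega>"
      using card_Un_le[of ?L ?R] by simp
  next
    fix v c assume v: "v \<in> P" "c < class_color F v"
    then obtain u where u: "u < v" "down_color F u = down_color F v" "up_color F u = up_color F v"
      "F ! u \<inter> F ! v \<noteq> {}" "class_color F u = c"
      using class_color_below by blast
    then have uP: "u \<in> P"
      using v(1) by (auto simp: P_def)
    \<comment> \<open>Since \<open>F ! u\<close> and \<open>F ! v\<close> meet,
      \<open>base_between\<close> applies, with their roles swapped when \<open>y\<close> is to the
      left of \<open>x\<close>.\<close>
    have "z \<in> J u \<union> J v"
      if xyz: "x \<in> J u \<inter> P" "y \<in> J v \<inter> P" "z \<in> P"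
        and btw: "?key x < ?key z \<and> ?key z < ?key y \<or> ?key y < ?key z \<and> ?key z < ?key x" for x y z
    proof -
      have "F ! u \<inter> base h1 h2 (F ! x) \<noteq> {}" "F ! v \<inter> base h1 h2 (F ! y) \<noteq> {}" "F ! v \<inter> F ! u \<noteq> {}"
        using xyz u(4) by (auto simp: J_def)
      note hits = this
      from btw have "F ! u \<inter> base h1 h2 (F ! z) \<noteq> {} \<or> F ! v \<inter> base h1 h2 (F ! z) \<noteq> {}"
      proof
        assume "?key x < ?key z \<and> ?key z < ?key y"
        then show ?thesis
          using mono[of x z] mono[of z y] xyz
          by (intro base_between[OF spanned[OF uP] spanned[OF v(1)] u(4) hits(1,2)]) auto
      next
        assume "?key y < ?key z \<and> ?key z < ?key x"
        then have "F ! v \<inter> base h1 h2 (F ! z) \<noteq> {} \<or> F ! u \<inter> base h1 h2 (F ! z) \<noteq> {}"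
          using mono[of y z] mono[of z x] xyz
          by (intro base_between[OF spanned[OF v(1)] spanned[OF uP] hits(3,2,1)]) auto
        then show ?thesis
          by blast
      qed
      then show ?thesis
        by (simp add: J_def)
    qed
    then show "\<exists>u\<in>P. class_color F u = c \<and> (\<forall>x\<in>J u \<inter> P. \<forall>y\<in>J v \<inter> P. \<forall>z\<in>P.
        (?key x < ?key z \<and> ?key z < ?key y) \<or> (?key y < ?key z \<and> ?key z < ?key x) \<longrightarrow> z \<in> J u \<union> J v)"
      using uP u(5) by blast
  qed
  moreover have "i \<in> P"
    using assms by (simp add: P_def)
  \<comment> \<open>The column bound \<open>11 * w\<close> is used with \<open>2 * \<omega>\<close>
    for \<open>w\<close>.\<close>
  ultimately show ?thesis
    using grundy_columns.color_le by fastforce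
qed

lemma card_colors_le:
  assumes "\<omega> \<ge> 1"
  shows "card (online_coloring strip_algorithm F ` fst (intersection_graph F)) \<le> 23 * \<omega> ^ 3"
proof -
  let ?enc = "\<lambda>(x, y, z). prod_encode (x, prod_encode (y, z))"
  \<comment> \<open>The class color is at most \<open>22 * \<omega>\<close>, hence below
    \<open>23 * \<omega>\<close> because \<open>\<omega> \<ge> 1\<close>.\<close>
  let ?B = "{..<\<omega>} \<times> {..<\<omega>} \<times> {..<23 * \<omega>}"
  have "online_coloring strip_algorithm F ` fst (intersection_graph F) \<subseteq> ?enc ` ?B"
  proof
    fix c assume "c \<in> online_coloring strip_algorithm F ` fst (intersection_graph F)"
    then obtain i where i: "i < length F" "c = strip_color F i"
      by (auto simp: intersection_graph_def online_coloring_strip_algorithm)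
    have "(down_color F i, up_color F i, class_color F i) \<in> ?B"
      using down_color_less up_color_less class_color_le[OF i(1)] i(1) assms by auto
    then show "c \<in> ?enc ` ?B"
      unfolding i(2) strip_color_def by (rule rev_image_eqI) simp
  qed
  then have "card (online_coloring strip_algorithm F ` fst (intersection_graph F)) \<le> card ?B"
    by (intro surj_card_le) auto
  also have "card ?B = 23 * \<omega> ^ 3"
    by (simp add: card_cartesian_product power3_eq_cube)
  finally show ?thesis .
qed

end

end

theorem theorem1:
  fixes h1 h2 :: real
  assumes "h1 \<noteq> h2"
  shows "\<exists>(A :: point set online_algorithm) (C :: real). C > 0 \<and>
    (\<forall>\<omega>::nat. \<omega> \<ge> 1 \<longrightarrow> (\<forall>F :: point set list.
       (\<forall>S\<in>set F. convex S \<and> spanned_between h1 h2 S) \<and>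
       clique_number (intersection_graph F) \<le> \<omega> \<longrightarrow>
         proper_coloring (intersection_graph F) (online_coloring A F) \<and>
         real (card (online_coloring A F ` fst (intersection_graph F))) \<le> C * real \<omega> ^ 3))"
proof -
  interpret two_lines h1 h2
    using assms by unfold_locales
  have "real (card (online_coloring strip_algorithm F ` fst (intersection_graph F))) \<le> 23 * real \<omega> ^ 3"
    if "\<omega> \<ge> 1" "\<forall>S\<in>set F. spanned S" "clique_number (intersection_graph F) \<le> \<omega>" for F and \<omega> :: nat
  proof -
    have "real (card (online_coloring strip_algorithm F ` fst (intersection_graph F))) \<le>
        real (23 * \<omega> ^ 3)"
      using card_colors_le[of F \<omega>] that by (intro of_nat_mono) blast
    then show ?thesis
      by simp
  qed
  then show ?thesis
    using proper_strip_algorithm by (intro exI[of _ strip_algorithm] exI[of _ 23]) auto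
qed

end
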